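(* Let $n, m$ be nonnegative integers, and let $f_0(k)$ denote the number of unlabeled $T_0$ topologies on $k$ points. Then: (i) $f_0(n+m) \geq f_0(n)\, f_0(m)$. (ii) If $n+m\ge 2$, then $f_0(n+m) \geq \max\{ f_0(i)\, f_0(m+n-i) : 1 \leq i \leq n+m-1 \}$.
   Context: For a nonnegative integer $k$ and a finite set $E$ with $|E|=k$, a topology on $E$ (a topology on $k$ points) is a collection $\tau$ of subsets of $E$ containing $\emptyset$ and $E$ and closed under (pairwise) union and intersection. It is $T_0$ if for any two distinct points $x,y \in E$ there exists $A \in \tau$ with $|\{x,y\} \cap A| = 1$. Topologies $\tau_1$ on $E_1$ and $\tau_2$ on $E_2$ are homeomorphic if there is a bijection $\varphi: E_1 \to E_2$ such that $\varphi(X) \in \tau_2$ if and only if $X \in \tau_1$, for all $X \subseteq E_1$. The number $f_0(k)$ of unlabeled $T_0$ topologies on $k$ points is the number of homeomorphism classes of $T_0$ topologies on a set of cardinality $k$. *)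

theory Defs
  imports "HOL-Analysis.Analysis"
begin

definition T0_topologies_on :: "'a set \<Rightarrow> 'a topology set" where
  "T0_topologies_on E = {X. topspace X = E \<and> t0_space X}"

definition homeo_rel :: "'a set \<Rightarrow> ('a topology \<times> 'a topology) set" where
  "homeo_rel E = {(X, Y). X \<in> T0_topologies_on E \<and> Y \<in> T0_topologies_on E \<and> X homeomorphic_space Y}"

definition homeo_classes :: "'a set \<Rightarrow> 'a topology set set" where
  "homeo_classes E = T0_topologies_on E // homeo_rel E"

(* The choice of {..<k} as the set of k points is immaterial: see card_homeo_classes. *)
definition f0 :: "nat \<Rightarrow> nat" where
  "f0 k = card (homeo_classes {..<k})"

(* On a finite set E, the library's topologies with carrier E are exactly the collections of
   subsets of E containing {} and E and closed under pairwise unions and intersections. *)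
lemma finite_topology_iff:
  assumes "finite E"
  shows "(\<exists>X. topspace X = E \<and> \<tau> = Collect (openin X)) \<longleftrightarrow>
    \<tau> \<subseteq> Pow E \<and> {} \<in> \<tau> \<and> E \<in> \<tau> \<and> (\<forall>A\<in>\<tau>. \<forall>B\<in>\<tau>. A \<union> B \<in> \<tau> \<and> A \<inter> B \<in> \<tau>)"
    (is "?L \<longleftrightarrow> ?R")
proof
  assume ?L
  then show ?R
    by (auto dest: openin_subset)
next
  assume R: ?R
  have un: "\<Union>\<K> \<in> \<tau>" if "\<K> \<subseteq> \<tau>" for \<K>
  proof -
    have "finite \<K>"
      by (meson R assms finite_Pow_iff finite_subset that)
    then show ?thesis
      using that R by (induction rule: finite_induct) auto
  qed
  have "istopology (\<lambda>U. U \<in> \<tau>)"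
    unfolding istopology_def
  proof (intro conjI strip)
    show "S \<inter> T \<in> \<tau>" if "S \<in> \<tau>" "T \<in> \<tau>" for S T
      using R that by blast
    show "\<Union>\<K> \<in> \<tau>" if "\<forall>K\<in>\<K>. K \<in> \<tau>" for \<K>
      using un [of \<K>] that by blast
  qed
  then have op: "openin (topology (\<lambda>U. U \<in> \<tau>)) = (\<lambda>U. U \<in> \<tau>)"
    by (simp add: topology_inverse')
  have "topspace (topology (\<lambda>U. U \<in> \<tau>)) = E"
    unfolding topspace_def op using R by auto
  with op show ?L
    by (intro exI [of _ "topology (\<lambda>U. U \<in> \<tau>)"]) simp
qed

lemma homeomorphic_space_iff_bij_betw:
  "X homeomorphic_space Y \<longleftrightarrow>
    (\<exists>\<phi>. bij_betw \<phi> (topspace X) (topspace Y) \<and>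
      (\<forall>U. U \<subseteq> topspace X \<longrightarrow> (openin Y (\<phi> ` U) \<longleftrightarrow> openin X U)))"
proof -
  have "homeomorphic_map X Y \<phi> \<longleftrightarrow> bij_betw \<phi> (topspace X) (topspace Y) \<and>
      (\<forall>U. U \<subseteq> topspace X \<longrightarrow> (openin Y (\<phi> ` U) \<longleftrightarrow> openin X U))" (is "?L \<longleftrightarrow> ?R") for \<phi>
  proof
    assume L: ?L
    then have "bij_betw \<phi> (topspace X) (topspace Y)"
      by (simp add: homeomorphic_eq_everything_map bij_betw_def)
    with L show ?R
      by (simp add: homeomorphic_map_openness)
  next
    assume R: ?R
    then have inj: "inj_on \<phi> (topspace X)" and im: "\<phi> ` topspace X = topspace Y"
      by (auto simp: bij_betw_def)
    have "openin X {x \<in> topspace X. \<phi> x \<in> U} \<longleftrightarrow> openin Y U" if "U \<subseteq> topspace Y" for U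
    proof -
      have "\<phi> ` {x \<in> topspace X. \<phi> x \<in> U} = U"
        using im that by auto
      moreover have "{x \<in> topspace X. \<phi> x \<in> U} \<subseteq> topspace X"
        by auto
      ultimately show ?thesis
        using R by metis
    qed
    with inj im show ?L
      by (simp add: homeomorphic_map_def quotient_map_def)
  qed
  then show ?thesis
    by (simp add: homeomorphic_space)
qed

lemma equiv_homeo_rel: "equiv (T0_topologies_on E) (homeo_rel E)"
proof (rule equivI)
  show "homeo_rel E \<subseteq> T0_topologies_on E \<times> T0_topologies_on E"
    by (auto simp: homeo_rel_def)
  show "refl_on (T0_topologies_on E) (homeo_rel E)"
    by (simp add: refl_on_def homeo_rel_def)
  show "sym (homeo_rel E)"
  proof (rule symI)
    show "(Y, X) \<in> homeo_rel E" if "(X, Y) \<in> homeo_rel E" for X Y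
      using that homeomorphic_space_sym [of X Y] by (simp add: homeo_rel_def)
  qed
  show "trans (homeo_rel E)"
  proof (rule transI)
    show "(X, Z) \<in> homeo_rel E" if "(X, Y) \<in> homeo_rel E" "(Y, Z) \<in> homeo_rel E" for X Y Z
      using that homeomorphic_space_trans [of X Y Z] by (simp add: homeo_rel_def)
  qed
qed

lemma finite_T0_topologies_on:
  assumes "finite E"
  shows "finite (T0_topologies_on E)"
proof (rule finite_imageD)
  show "finite ((\<lambda>X. Collect (openin X)) ` T0_topologies_on E)"
    by (rule finite_subset [of _ "Pow (Pow E)"])
      (use assms in \<open>auto simp: T0_topologies_on_def dest: openin_subset\<close>)
  show "inj_on (\<lambda>X. Collect (openin X)) (T0_topologies_on E)"
    by (auto simp: inj_on_def topology_eq set_eq_iff)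
qed

lemma finite_homeo_classes: "finite E \<Longrightarrow> finite (homeo_classes E)"
  unfolding homeo_classes_def
  by (rule finite_quotient [OF finite_T0_topologies_on]) (auto simp: homeo_rel_def)

lemma transport_topology:
  assumes "bij_betw g (topspace X) F"
  shows "\<exists>Y. topspace Y = F \<and> X homeomorphic_space Y"
proof -
  define h where "h = inv_into (topspace X) g"
  define Y where "Y = pullback_topology F h X"
  have im: "g ` topspace X = F" and inj: "inj_on g (topspace X)"
    using assms by (auto simp: bij_betw_def)
  have h: "h y \<in> topspace X" "g (h y) = y" if "y \<in> F" for y
    using that im by (auto simp: h_def inv_into_into f_inv_into_f)
  have hg: "h (g x) = x" if "x \<in> topspace X" for x
    using that inj by (simp add: h_def)
  have top: "topspace Y = F"
    using h by (auto simp: Y_def topspace_pullback_topology)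
  have "continuous_map Y X h"
    unfolding Y_def using continuous_map_pullback [of X X id F h] by simp
  moreover have "continuous_map X Y g"
    unfolding Y_def
  proof (rule continuous_map_pullback')
    show "continuous_map X X (h \<circ> g)"
      by (rule continuous_map_eq [of _ _ id]) (auto simp: hg)
    show "topspace X \<subseteq> g -` F"
      using im by auto
  qed
  ultimately have "homeomorphic_maps X Y g h"
    using h hg top by (simp add: homeomorphic_maps_def)
  with top show ?thesis
    unfolding homeomorphic_space_def by blast
qed

lemma card_homeo_classes_le:
  fixes E :: "'a set" and F :: "'b set"
  assumes "bij_betw g E F" "finite F"
  shows "card (homeo_classes E) \<le> card (homeo_classes F)"
proof -
  define R where "R C D \<longleftrightarrow> (\<exists>X\<in>C. \<exists>Y\<in>D. X homeomorphic_space Y)"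
    for C :: "'a topology set" and D :: "'b topology set"
  have ex: "\<exists>D\<in>homeo_classes F. R C D" if C: "C \<in> homeo_classes E" for C
  proof -
    obtain X where X: "X \<in> T0_topologies_on E" "C = homeo_rel E `` {X}"
      using C unfolding homeo_classes_def by (elim quotientE)
    then have "bij_betw g (topspace X) F"
      using assms by (simp add: T0_topologies_on_def)
    then obtain Y where Y: "topspace Y = F" "X homeomorphic_space Y"
      using transport_topology by blast
    then have YF: "Y \<in> T0_topologies_on F"
      using X homeomorphic_t0_space by (auto simp: T0_topologies_on_def)
    have "R C (homeo_rel F `` {Y})"
      using X Y YF by (auto simp: R_def homeo_rel_def)
    with YF show ?thesis
      by (auto simp: homeo_classes_def intro: quotientI)
  qed
  have uniq: "C = C'" if "C \<in> homeo_classes E" "C' \<in> homeo_classes E" "D \<in> homeo_classes F"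
      "R C D" "R C' D" for C C' D
  proof -
    obtain X Y X' Y' where *: "X \<in> C" "Y \<in> D" "X homeomorphic_space Y"
        "X' \<in> C'" "Y' \<in> D" "X' homeomorphic_space Y'"
      using \<open>R C D\<close> \<open>R C' D\<close> unfolding R_def by blast
    have "(Y, Y') \<in> homeo_rel F"
      using * that quotient_eq_iff [OF equiv_homeo_rel] unfolding homeo_classes_def by blast
    then have "X homeomorphic_space X'"
      using * by (metis (mono_tags, lifting) case_prodD homeo_rel_def homeomorphic_space_sym
          homeomorphic_space_trans mem_Collect_eq)
    moreover have "X \<in> T0_topologies_on E" "X' \<in> T0_topologies_on E"
      using * that in_quotient_imp_subset [OF equiv_homeo_rel] unfolding homeo_classes_def by blast+
    ultimately have "(X, X') \<in> homeo_rel E"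
      by (simp add: homeo_rel_def)
    then show ?thesis
      using * that quotient_eq_iff [OF equiv_homeo_rel] unfolding homeo_classes_def by blast
  qed
  obtain f where f: "\<And>C. C \<in> homeo_classes E \<Longrightarrow> f C \<in> homeo_classes F \<and> R C (f C)"
    using ex by metis
  then have "inj_on f (homeo_classes E)"
    by (metis inj_onI uniq)
  with f show ?thesis
    by (meson assms(2) card_inj_on_le finite_homeo_classes image_subsetI)
qed

lemma card_homeo_classes:
  assumes "finite E"
  shows "card (homeo_classes E) = f0 (card E)"
proof -
  obtain g where g: "bij_betw g E {..<card E}"
    using assms ex_bij_betw_finite_nat atLeast0LessThan by metis
  then show ?thesis
    unfolding f0_def
    using card_homeo_classes_le [OF g] card_homeo_classes_le [OF bij_betw_inv_into [OF g] assms]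
    by simp
qed

end

theory Submission
  imports Defs
begin

text \<open>
  The inequality comes from an injection given by the ordinal sum. Put a space \<open>X\<close> on \<open>n\<close> points
  under a disjoint space \<open>Y\<close> on \<open>m\<close> points, so that the open sets are those of \<open>X\<close> together with
  all of \<open>X\<close> enlarged by an open set of \<open>Y\<close>; in the language of finite posets (with open sets as
  down-sets) every point of \<open>X\<close> is placed below every point of \<open>Y\<close>. The result is \<open>T\<^sub>0\<close> if \<open>X\<close> and
  \<open>Y\<close> are (\<open>t0_space_ordinal_sum\<close>).

  The homeomorphism type of the sum, together with the number \<open>n\<close>, determines those of \<open>X\<close> and \<open>Y\<close>
  (\<open>homeomorphic_ordinal_sum_imp\<close>). Indeed every open set of the sum is comparable under inclusion
  with the lower block \<open>topspace X\<close>, which is itself open. Two finite sets of the same size that are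
  comparable are equal, so the lower block is the only open set with \<open>n\<close> elements. A
  homeomorphism between two such sums therefore carries lower block to lower block and upper
  block to upper block, and restricts to homeomorphisms of the summands. Hence sending a pair of
  homeomorphism classes to the class of the ordinal sum of representatives is injective.

  The second claim is the first one, applied to each decomposition of \<open>n + m\<close> into \<open>i\<close> and
  \<open>m + n - i\<close>.
\<close>

definition ordinal_sum :: "'a topology \<Rightarrow> 'a topology \<Rightarrow> 'a topology" where
  "ordinal_sum X Y = topology (\<lambda>U. openin X U \<or> (\<exists>V. openin Y V \<and> U = topspace X \<union> V))"

lemma openin_ordinal_sum:
  "openin (ordinal_sum X Y) U \<longleftrightarrow> openin X U \<or> (\<exists>V. openin Y V \<and> U = topspace X \<union> V)"
proof -
  let ?P = "\<lambda>U. openin X U \<or> (\<exists>V. openin Y V \<and> U = topspace X \<union> V)"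
  have "istopology ?P"
    unfolding istopology_def
  proof (intro conjI strip)
    fix S T
    assume "?P S" "?P T"
    moreover have "S \<inter> (topspace X \<union> V) = S" if "openin X S" for S V
      using openin_subset [OF that] by blast
    moreover have "(topspace X \<union> V) \<inter> (topspace X \<union> W) = topspace X \<union> (V \<inter> W)" for V W
      by blast
    ultimately show "?P (S \<inter> T)"
      by (metis Int_commute openin_Int)
  next
    fix \<K>
    assume \<K>: "\<forall>K\<in>\<K>. ?P K"
    show "?P (\<Union>\<K>)"
    proof (cases "\<forall>K\<in>\<K>. openin X K")
      case True
      then show ?thesis
        by blast
    next
      case False
      \<comment> \<open>One member already contains the lower block, so it absorbs all members open in \<open>X\<close>.\<close>
      define \<V> where "\<V> = {V. openin Y V \<and> topspace X \<union> V \<in> \<K>}"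
      obtain V0 where "V0 \<in> \<V>"
        using False \<K> by (auto simp: \<V>_def)
      moreover have "K \<subseteq> topspace X \<union> \<Union>\<V>" if "K \<in> \<K>" for K
        using \<K> that openin_subset [of X K] by (auto simp: \<V>_def)
      ultimately have "\<Union>\<K> = topspace X \<union> \<Union>\<V>"
        by (auto simp: \<V>_def)
      moreover have "openin Y (\<Union>\<V>)"
        by (auto simp: \<V>_def)
      ultimately show ?thesis
        by blast
    qed
  qed
  then show ?thesis
    by (simp add: ordinal_sum_def topology_inverse')
qed

lemma topspace_ordinal_sum [simp]: "topspace (ordinal_sum X Y) = topspace X \<union> topspace Y"
proof
  have "openin (ordinal_sum X Y) (topspace X \<union> topspace Y)"
    unfolding openin_ordinal_sum by blast
  then show "topspace X \<union> topspace Y \<subseteq> topspace (ordinal_sum X Y)"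
    by (rule openin_subset)
  have "openin (ordinal_sum X Y) (topspace (ordinal_sum X Y))"
    by simp
  then show "topspace (ordinal_sum X Y) \<subseteq> topspace X \<union> topspace Y"
    unfolding openin_ordinal_sum using openin_subset by blast
qed

lemma openin_ordinal_sum_comparable:
  assumes "openin (ordinal_sum X Y) U"
  shows "U \<subseteq> topspace X \<or> topspace X \<subseteq> U"
  using assms openin_subset [of X U] by (auto simp: openin_ordinal_sum)

lemma subtopology_ordinal_sum_lower: "subtopology (ordinal_sum X Y) (topspace X) = X"
proof -
  have "(\<exists>T. openin (ordinal_sum X Y) T \<and> U = T \<inter> topspace X) \<longleftrightarrow> openin X U" for U
  proof
    assume "\<exists>T. openin (ordinal_sum X Y) T \<and> U = T \<inter> topspace X"
    then obtain T where T: "openin (ordinal_sum X Y) T" "U = T \<inter> topspace X"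
      by blast
    from T(1) consider "openin X T" | "topspace X \<subseteq> T"
      by (auto simp: openin_ordinal_sum)
    then show "openin X U"
      using T(2) by cases (auto simp: Int_absorb1)
  next
    assume "openin X U"
    then show "\<exists>T. openin (ordinal_sum X Y) T \<and> U = T \<inter> topspace X"
      using openin_subset [of X U] by (intro exI [of _ U]) (auto simp: openin_ordinal_sum)
  qed
  then show ?thesis
    by (simp add: topology_eq openin_subtopology)
qed

lemma subtopology_ordinal_sum_upper:
  assumes "disjnt (topspace X) (topspace Y)"
  shows "subtopology (ordinal_sum X Y) (topspace Y) = Y"
proof -
  have "(\<exists>T. openin (ordinal_sum X Y) T \<and> U = T \<inter> topspace Y) \<longleftrightarrow> openin Y U" for U
  proof
    assume "\<exists>T. openin (ordinal_sum X Y) T \<and> U = T \<inter> topspace Y"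
    then obtain T where T: "openin (ordinal_sum X Y) T" "U = T \<inter> topspace Y"
      by blast
    from T(1) consider "openin X T" | V where "openin Y V" "T = topspace X \<union> V"
      by (auto simp: openin_ordinal_sum)
    then show "openin Y U"
    proof cases
      case 1
      then have "U = {}"
        using T(2) assms openin_subset [of X T] by (auto simp: disjnt_iff)
      then show ?thesis
        by simp
    next
      case 2
      then have "U = V"
        using T(2) assms openin_subset [of Y V] by (auto simp: disjnt_iff)
      with 2 show ?thesis
        by simp
    qed
  next
    assume U: "openin Y U"
    then have "U = (topspace X \<union> U) \<inter> topspace Y"
      using assms openin_subset [of Y U] by (auto simp: disjnt_iff)
    with U show "\<exists>T. openin (ordinal_sum X Y) T \<and> U = T \<inter> topspace Y"
      by (auto simp: openin_ordinal_sum)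
  qed
  then show ?thesis
    by (simp add: topology_eq openin_subtopology)
qed

text \<open>
  Two points of the same block are separated inside that block; two points of different blocks are
  separated by the lower block, which is open.
\<close>

lemma t0_space_ordinal_sum:
  assumes "t0_space X" "t0_space Y" and disj: "disjnt (topspace X) (topspace Y)"
  shows "t0_space (ordinal_sum X Y)"
  unfolding t0_space_def
proof (intro ballI impI)
  fix x y
  assume x: "x \<in> topspace (ordinal_sum X Y)" and y: "y \<in> topspace (ordinal_sum X Y)"
    and "x \<noteq> y"
  consider (lower) "x \<in> topspace X" "y \<in> topspace X" | (upper) "x \<in> topspace Y" "y \<in> topspace Y"
    | (mixed) "x \<in> topspace X \<longleftrightarrow> y \<notin> topspace X"
    using x y by auto
  then show "\<exists>U. openin (ordinal_sum X Y) U \<and> (x \<notin> U \<longleftrightarrow> y \<in> U)"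
  proof cases
    case lower
    then obtain U where "openin X U" "x \<notin> U \<longleftrightarrow> y \<in> U"
      using assms(1) \<open>x \<noteq> y\<close> unfolding t0_space_def by blast
    then show ?thesis
      by (auto simp: openin_ordinal_sum)
  next
    case upper
    then obtain V where "openin Y V" "x \<notin> V \<longleftrightarrow> y \<in> V"
      using assms(2) \<open>x \<noteq> y\<close> unfolding t0_space_def by blast
    moreover have "x \<notin> topspace X" "y \<notin> topspace X"
      using upper disj by (auto simp: disjnt_iff)
    ultimately show ?thesis
      by (intro exI [of _ "topspace X \<union> V"]) (auto simp: openin_ordinal_sum)
  next
    case mixed
    then show ?thesis
      by (intro exI [of _ "topspace X"]) (auto simp: openin_ordinal_sum)
  qed
qed

text \<open>
  Ordinal sums can be cancelled once the size of the lower block is known: the image of the lower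
  block under a homeomorphism is an open set of that size, hence it is the other lower block by
  comparability.
\<close>

lemma homeomorphic_ordinal_sum_imp:
  assumes homeo: "ordinal_sum X Y homeomorphic_space ordinal_sum X' Y'"
    and disj: "disjnt (topspace X) (topspace Y)" "disjnt (topspace X') (topspace Y')"
    and fin: "finite (topspace X)" "finite (topspace X')"
    and card: "card (topspace X) = card (topspace X')"
  shows "X homeomorphic_space X'" "Y homeomorphic_space Y'"
proof -
  let ?Z = "ordinal_sum X Y" and ?Z' = "ordinal_sum X' Y'"
  obtain \<phi> where \<phi>: "homeomorphic_map ?Z ?Z' \<phi>"
    using homeo by (auto simp: homeomorphic_space)
  then have im: "\<phi> ` (topspace X \<union> topspace Y) = topspace X' \<union> topspace Y'"
    and inj: "inj_on \<phi> (topspace X \<union> topspace Y)"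
    by (simp_all add: homeomorphic_eq_everything_map)
  have "openin ?Z (topspace X)"
    by (simp add: openin_ordinal_sum)
  then have "openin ?Z' (\<phi> ` topspace X)"
    using \<phi> by (simp add: homeomorphic_map_openness)
  then have "\<phi> ` topspace X \<subseteq> topspace X' \<or> topspace X' \<subseteq> \<phi> ` topspace X"
    by (rule openin_ordinal_sum_comparable)
  moreover have "card (\<phi> ` topspace X) = card (topspace X')"
    using card inj by (simp add: card_image inj_on_Un)
  ultimately have lower: "\<phi> ` topspace X = topspace X'"
    using fin by (metis card_subset_eq finite_imageI)
  have "\<phi> ` topspace Y = \<phi> ` ((topspace X \<union> topspace Y) - topspace X)"
    using disj by (auto simp: disjnt_iff intro!: arg_cong [of _ _ "image \<phi>"])
  also have "\<dots> = (topspace X' \<union> topspace Y') - topspace X'"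
    using inj_on_image_set_diff [OF inj, of "topspace X \<union> topspace Y" "topspace X"] im lower
    by auto
  also have "\<dots> = topspace Y'"
    using disj by (auto simp: disjnt_iff)
  finally have upper: "\<phi> ` topspace Y = topspace Y'" .
  have "homeomorphic_map (subtopology ?Z (topspace X)) (subtopology ?Z' (topspace X')) \<phi>"
    using homeomorphic_map_subtopologies [OF \<phi>] lower by (simp add: Int_absorb1)
  then show "X homeomorphic_space X'"
    by (auto simp: subtopology_ordinal_sum_lower homeomorphic_space)
  have "homeomorphic_map (subtopology ?Z (topspace Y)) (subtopology ?Z' (topspace Y')) \<phi>"
    using homeomorphic_map_subtopologies [OF \<phi>] upper by (simp add: Int_absorb1)
  then show "Y homeomorphic_space Y'"
    using disj by (auto simp: subtopology_ordinal_sum_upper homeomorphic_space)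
qed

text \<open>
  Classes are summed through chosen representatives. Injectivity only requires cancelling the
  summands up to homeomorphism, so the sum never has to be shown to respect homeomorphism.
\<close>

lemma card_homeo_classes_Un_ge:
  assumes "finite E" "finite F" and disj: "disjnt E F"
  shows "card (homeo_classes E) * card (homeo_classes F) \<le> card (homeo_classes (E \<union> F))"
proof -
  define rep where
    "rep G C = (SOME X. X \<in> T0_topologies_on G \<and> C = homeo_rel G `` {X})" for C and G :: "'a set"
  have rep: "rep G C \<in> T0_topologies_on G \<and> C = homeo_rel G `` {rep G C}"
    if "C \<in> homeo_classes G" for C and G :: "'a set"
  proof -
    have "\<exists>X. X \<in> T0_topologies_on G \<and> C = homeo_rel G `` {X}"
      using that unfolding homeo_classes_def by (auto elim: quotientE)
    then show ?thesis
      unfolding rep_def by (rule someI_ex)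
  qed
  define s where "s = (\<lambda>(C, D). ordinal_sum (rep E C) (rep F D))"
  have s: "s p \<in> T0_topologies_on (E \<union> F)" if "p \<in> homeo_classes E \<times> homeo_classes F" for p
    using that rep disj
    by (auto simp: s_def T0_topologies_on_def intro!: t0_space_ordinal_sum)
  have "inj_on (\<lambda>p. homeo_rel (E \<union> F) `` {s p}) (homeo_classes E \<times> homeo_classes F)"
  proof (rule inj_onI)
    fix p q
    assume p: "p \<in> homeo_classes E \<times> homeo_classes F"
      and q: "q \<in> homeo_classes E \<times> homeo_classes F"
      and eq: "homeo_rel (E \<union> F) `` {s p} = homeo_rel (E \<union> F) `` {s q}"
    obtain C D C' D' where [simp]: "p = (C, D)" "q = (C', D')"
      by (cases p, cases q)
    have C: "C \<in> homeo_classes E" "C' \<in> homeo_classes E"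
      and D: "D \<in> homeo_classes F" "D' \<in> homeo_classes F"
      using p q by auto
    have top: "topspace (rep E C) = E" "topspace (rep E C') = E"
      "topspace (rep F D) = F" "topspace (rep F D') = F"
      using rep C D by (auto simp: T0_topologies_on_def)
    have "(s p, s q) \<in> homeo_rel (E \<union> F)"
      using eq_equiv_class [OF eq equiv_homeo_rel] s q by blast
    then have "ordinal_sum (rep E C) (rep F D) homeomorphic_space
        ordinal_sum (rep E C') (rep F D')"
      by (simp add: homeo_rel_def s_def)
    then have "rep E C homeomorphic_space rep E C'" "rep F D homeomorphic_space rep F D'"
      using homeomorphic_ordinal_sum_imp [of "rep E C" "rep F D" "rep E C'" "rep F D'"]
        top disj \<open>finite E\<close> by simp_all
    then have "(rep E C, rep E C') \<in> homeo_rel E" "(rep F D, rep F D') \<in> homeo_rel F"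
      using rep C D by (auto simp: homeo_rel_def)
    then have "C = C'" "D = D'"
      using rep [OF C(1)] rep [OF C(2)] rep [OF D(1)] rep [OF D(2)]
        equiv_class_eq [OF equiv_homeo_rel] by metis+
    then show "p = q"
      by simp
  qed
  moreover have "(\<lambda>p. homeo_rel (E \<union> F) `` {s p}) ` (homeo_classes E \<times> homeo_classes F)
      \<subseteq> homeo_classes (E \<union> F)"
    using s by (auto simp: homeo_classes_def intro!: quotientI)
  ultimately have "card (homeo_classes E \<times> homeo_classes F) \<le> card (homeo_classes (E \<union> F))"
    using assms by (intro card_inj_on_le finite_homeo_classes) auto
  then show ?thesis
    by (simp add: card_cartesian_product)
qed

lemma f0_add_ge: "f0 n * f0 m \<le> f0 (n + m)"
proof -
  have "card (homeo_classes {..<n}) = f0 n" "card (homeo_classes {n..<n + m}) = f0 m"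
    "card (homeo_classes ({..<n} \<union> {n..<n + m})) = f0 (n + m)"
    by (simp_all add: card_homeo_classes card_Un_disjoint ivl_disj_int)
  moreover have "disjnt {..<n} {n..<n + m}"
    by (auto simp: disjnt_iff)
  ultimately show ?thesis
    using card_homeo_classes_Un_ge [of "{..<n}" "{n..<n + m}"] by simp
qed

theorem corollary3p5:
  fixes n m :: nat
  shows "f0 (n + m) \<ge> f0 n * f0 m \<and>
    (n + m \<ge> 2 \<longrightarrow> f0 (n + m) \<ge> Max {f0 i * f0 (m + n - i) | i. 1 \<le> i \<and> i \<le> n + m - 1})"
proof (intro conjI impI)
  show "f0 n * f0 m \<le> f0 (n + m)"
    by (rule f0_add_ge)
next
  assume "2 \<le> n + m"
  let ?S = "{f0 i * f0 (m + n - i) | i. 1 \<le> i \<and> i \<le> n + m - 1}"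
  have "?S = (\<lambda>i. f0 i * f0 (m + n - i)) ` {1..n + m - 1}"
    by auto
  moreover have "{1..n + m - 1} \<noteq> {}"
    using \<open>2 \<le> n + m\<close> by simp
  ultimately have "finite ?S" "?S \<noteq> {}"
    by simp_all
  moreover have "f0 i * f0 (m + n - i) \<le> f0 (n + m)" if "i \<le> n + m - 1" for i
    using f0_add_ge [of i "m + n - i"] that by (simp add: add.commute)
  ultimately show "Max ?S \<le> f0 (n + m)"
    by auto
qed

end
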